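(* Let $(A,\mu,\Delta,\alpha,r)$ be a quasi-triangular $\epsilon$-Hom-bialgebra with $r$ anti-symmetric. Then $$A_{HLie}=(A,[-,-]=\mu\circ(Id-\tau),\delta=(Id-\tau)\circ\Delta,\alpha,r)$$ is a quasi-triangular Hom-Lie bialgebra.
   Context: Throughout, $\mathbf{k}$ is a fixed field of characteristic $0$; vector spaces, linear maps and tensor products are over $\mathbf{k}$. $\tau$ denotes the twist $\tau(x\otimes y)=y\otimes x$. A $2$-tensor $r$ is anti-symmetric if $\tau(r)=-r$, and $\alpha$-invariant if $\alpha^{\otimes 2}(r)=r$. An $\epsilon$-Hom-bialgebra $(A,\mu,\Delta,\alpha)$ is a $\mathbf{k}$-vector space $A$ with linear maps $\mu\colon A^{\otimes 2}\to A$, $\Delta\colon A\to A^{\otimes 2}$, $\alpha\colon A\to A$ such that: $\alpha\circ\mu=\mu\circ\alpha^{\otimes 2}$; $\mu\circ(\alpha\otimes\mu)=\mu\circ(\mu\otimes\alpha)$; $\alpha^{\otimes 2}\circ\Delta=\Delta\circ\alpha$; $(\alpha\otimes\Delta)\circ\Delta=(\Delta\otimes\alpha)\circ\Delta$; and $\Delta\circ\mu=(\mu\otimes\alpha)\circ(\alpha\otimes\Delta)+(\alpha\otimes\mu)\circ(\Delta\otimes\alpha)$. For $a\in A$ and $r=\sum u_i\otimes v_i\in A^{\otimes 2}$, set $[a,r]_*=\sum\mu(a,u_i)\otimes\alpha(v_i)-\alpha(u_i)\otimes\mu(v_i,a)$. A coboundary $\epsilon$-Hom-bialgebra $(A,\mu,\Delta,\alpha,r)$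 is an $\epsilon$-Hom-bialgebra $(A,\mu,\Delta,\alpha)$ together with an $\alpha$-invariant $r\in A^{\otimes 2}$ such that $\Delta=[-,r]_*$. It is a quasi-triangular $\epsilon$-Hom-bialgebra if moreover $A(r)=0$, where $$A(r)=\sum_{i,j}\mu(u_i,u_j)\otimes\alpha(v_j)\otimes\alpha(v_i)-\sum_{i,j}\alpha(u_i)\otimes\mu(v_i,u_j)\otimes\alpha(v_j)+\sum_{i,j}\alpha(u_j)\otimes\alpha(u_i)\otimes\mu(v_i,v_j).$$ Let $\sigma$ denote the cyclic permutation $(1\,2\,3)$ acting on $3$-fold tensors. A Hom-Lie algebra $(L,[-,-],\alpha)$ is a vector space $L$ with a linear map $\alpha\colon L\to L$ and an anti-symmetric bilinear bracket such that $\alpha\circ[-,-]=[-,-]\circ\alpha^{\otimes 2}$ and $[-,-]\circ([-,-]\otimes\alpha)\circ(Id+\sigma+\sigma^2)=0$, i.e. $[[x,y],\alpha(z)]+[[z,x],\alpha(y)]+[[y,z],\alpha(x)]=0$. A Hom-Lie coalgebra $(L,\delta,\alpha)$ is a vector space $L$ with linear maps $\alpha\colon L\to L$ and $\delta\colon L\to L^{\otimes 2}$ such that $\delta\circ\alpha=\alpha^{\otimes 2}\circ\delta$, $\tau\circ\delta=-\delta$, and $(Id+\sigma+\sigma^2)\circ(\alpha\otimes\delta)\circ\delta=0$. For $x\in L$, set $\mathrm{ad}_x(y_1\otimes y_2)=[x,y_1]\otimes\alpha(y_2)+\alpha(y_1)\otimes[x,y_2]$ on $L^{\otimes 2}$ (extended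 linearly); for $\gamma\in L^{\otimes 2}$, $\mathrm{ad}(\gamma)(x)=\mathrm{ad}_x(\gamma)$. A Hom-Lie bialgebra $(L,[-,-],\delta,\alpha)$ is a quadruple such that $(L,[-,-],\alpha)$ is a Hom-Lie algebra, $(L,\delta,\alpha)$ is a Hom-Lie coalgebra, and $\delta([x,y])=\mathrm{ad}_{\alpha(x)}(\delta(y))-\mathrm{ad}_{\alpha(y)}(\delta(x))$ for all $x,y\in L$. A coboundary Hom-Lie bialgebra $(L,[-,-],\delta,\alpha,r)$ is a Hom-Lie bialgebra together with an $\alpha$-invariant $r\in L^{\otimes 2}$ such that $\delta=\mathrm{ad}(r)$. It is a quasi-triangular Hom-Lie bialgebra if moreover $r=\sum u_i\otimes v_i$ satisfies the classical Hom-Yang-Baxter equation $C(r)=0$, where $$C(r)=\sum_{i,j}[u_i,u_j]\otimes\alpha(v_i)\otimes\alpha(v_j)+\sum_{i,j}\alpha(u_i)\otimes[v_i,u_j]\otimes\alpha(v_j)+\sum_{i,j}\alpha(u_i)\otimes\alpha(u_j)\otimes[v_i,v_j].$$ *)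

theory Defs
  imports Complex_Main "HOL-Library.Poly_Mapping"
begin

section \<open>Free vector spaces and their quotients\<close>

text \<open>The type \<open>'x \<Rightarrow>\<^sub>0 'k\<close> is the free \<open>'k\<close>-vector space on \<open>'x\<close>; its elements are formal sums.\<close>

definition fscale :: "'k::field \<Rightarrow> ('x \<Rightarrow>\<^sub>0 'k) \<Rightarrow> ('x \<Rightarrow>\<^sub>0 'k)" where
  "fscale c p = Poly_Mapping.map ((*) c) p"

definition gen :: "'x \<Rightarrow> ('x \<Rightarrow>\<^sub>0 'k::field)" where
  "gen x = Poly_Mapping.single x 1"

definition lin_ext :: "('x \<Rightarrow> ('y \<Rightarrow>\<^sub>0 'k::field)) \<Rightarrow> ('x \<Rightarrow>\<^sub>0 'k) \<Rightarrow> ('y \<Rightarrow>\<^sub>0 'k)" where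
  "lin_ext f p = (\<Sum>x\<in>Poly_Mapping.keys p. fscale (Poly_Mapping.lookup p x) (f x))"

lemma lookup_fscale [simp]:
  "Poly_Mapping.lookup (fscale c p) x = c * Poly_Mapping.lookup p x"
  by (simp add: fscale_def map.rep_eq when_def)

interpretation free: vector_space fscale
  by unfold_locales
    (auto intro!: poly_mapping_eqI simp: lookup_add algebra_simps)

lemma lin_ext_superset:
  assumes "finite S" "Poly_Mapping.keys p \<subseteq> S"
  shows "lin_ext f p = (\<Sum>x\<in>S. fscale (Poly_Mapping.lookup p x) (f x))"
  unfolding lin_ext_def using assms
  by (intro sum.mono_neutral_left) (auto simp: in_keys_iff)

lemma lin_ext_add: "lin_ext f (p + q) = lin_ext f p + lin_ext f q"
proof -
  let ?S = "Poly_Mapping.keys p \<union> Poly_Mapping.keys q"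
  have "Poly_Mapping.keys (p + q) \<subseteq> ?S"
    by (rule Poly_Mapping.keys_add)
  then show ?thesis
    by (simp add: lin_ext_superset[of ?S] lookup_add free.scale_left_distrib sum.distrib)
qed

lemma lin_ext_scale: "lin_ext f (fscale c p) = fscale c (lin_ext f p)"
proof -
  have "Poly_Mapping.keys (fscale c p) \<subseteq> Poly_Mapping.keys p"
    by (auto simp: in_keys_iff)
  then show ?thesis
    by (simp add: lin_ext_superset[of "Poly_Mapping.keys p"] free.scale_sum_right)
qed

lemma linear_lin_ext: "Vector_Spaces.linear fscale fscale (lin_ext f)"
  by unfold_locales (simp_all add: lin_ext_add lin_ext_scale)

lemma lin_ext_diff: "lin_ext f (p - q) = lin_ext f p - lin_ext f q"
  using Vector_Spaces.linear.axioms(3)[OF linear_lin_ext] by (rule module_hom.diff)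

lemma lin_ext_gen [simp]: "lin_ext f (gen x) = f x"
  by (simp add: lin_ext_def gen_def)

text \<open>For a subspace \<open>N\<close> of a free vector space \<open>F\<close>, an element of \<open>F / N\<close> is a coset, and the
  operations on \<open>F / N\<close> are computed on representatives.\<close>

definition coset :: "('x \<Rightarrow>\<^sub>0 'k::field) set \<Rightarrow> ('x \<Rightarrow>\<^sub>0 'k) \<Rightarrow> ('x \<Rightarrow>\<^sub>0 'k) set" where
  "coset N p = {q. q - p \<in> N}"

definition rep :: "('x \<Rightarrow>\<^sub>0 'k::field) set \<Rightarrow> ('x \<Rightarrow>\<^sub>0 'k)" where
  "rep T = (SOME p. p \<in> T)"

definition qadd where "qadd N S T = coset N (rep S + rep T)"
definition qminus where "qminus N S T = coset N (rep S - rep T)"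
definition quminus where "quminus N T = coset N (- rep T)"
definition qscale where "qscale N c T = coset N (fscale c (rep T))"
definition qzero where "qzero N = coset N 0"

text \<open>If \<open>f\<close> takes values in \<open>F / N\<close> and respects the relations defining a quotient of the free
  vector space on \<open>'x\<close>, then \<open>lift N f\<close> is the linear map on that quotient which sends the class
  of the generator \<open>x\<close> to \<open>f x\<close>. In other words, \<open>lift N f T = (\<Sum>i. c\<^sub>i f(x\<^sub>i))\<close> for any
  representative \<open>\<Sum>i. c\<^sub>i x\<^sub>i\<close> of \<open>T\<close>.\<close>

definition lift ::
  "('y \<Rightarrow>\<^sub>0 'k::field) set \<Rightarrow> ('x \<Rightarrow> ('y \<Rightarrow>\<^sub>0 'k) set) \<Rightarrow> ('x \<Rightarrow>\<^sub>0 'k) set \<Rightarrow> ('y \<Rightarrow>\<^sub>0 'k) set" where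
  "lift N f T = coset N (lin_ext (\<lambda>x. rep (f x)) (rep T))"

lemma coset_eq_iff:
  assumes "free.subspace N"
  shows "coset N p = coset N q \<longleftrightarrow> p - q \<in> N"
proof
  assume "coset N p = coset N q"
  moreover have "p \<in> coset N p"
    using assms by (simp add: coset_def free.subspace_0)
  ultimately show "p - q \<in> N"
    by (simp add: coset_def)
next
  assume pq: "p - q \<in> N"
  have "s - p \<in> N \<longleftrightarrow> s - q \<in> N" for s
    using free.subspace_add[OF assms, of "s - p" "p - q"]
      free.subspace_diff[OF assms, of "s - q" "p - q"] pq by auto
  then show "coset N p = coset N q"
    by (simp add: coset_def)
qed

lemma rep_coset:
  assumes "free.subspace N"
  shows "rep (coset N p) - p \<in> N"
proof -
  have "p \<in> coset N p"
    using assms by (simp add: coset_def free.subspace_0)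
  then have "rep (coset N p) \<in> coset N p"
    unfolding rep_def by (rule someI)
  then show ?thesis
    by (simp add: coset_def)
qed

lemma coset_rep:
  assumes "free.subspace N" "T \<in> range (coset N)"
  shows "coset N (rep T) = T"
proof -
  obtain p where "T = coset N p"
    using assms(2) by blast
  then show ?thesis
    using assms(1) by (simp only: coset_eq_iff rep_coset)
qed

lemma qadd_coset:
  assumes "free.subspace N"
  shows "qadd N (coset N p) (coset N q) = coset N (p + q)"
  using free.subspace_add[OF assms rep_coset[OF assms, of p] rep_coset[OF assms, of q]]
  by (simp add: qadd_def coset_eq_iff[OF assms] algebra_simps)

lemma qminus_coset:
  assumes "free.subspace N"
  shows "qminus N (coset N p) (coset N q) = coset N (p - q)"
  using free.subspace_diff[OF assms rep_coset[OF assms, of p] rep_coset[OF assms, of q]]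
  by (simp add: qminus_def coset_eq_iff[OF assms] algebra_simps)

lemma quminus_coset:
  assumes "free.subspace N"
  shows "quminus N (coset N p) = coset N (- p)"
  using free.subspace_neg[OF assms rep_coset[OF assms, of p]]
  by (simp add: quminus_def coset_eq_iff[OF assms] algebra_simps)

lemma qscale_coset:
  assumes "free.subspace N"
  shows "qscale N c (coset N p) = coset N (fscale c p)"
  using free.subspace_scale[OF assms rep_coset[OF assms, of p], of c]
  by (simp add: qscale_def coset_eq_iff[OF assms] free.scale_right_diff_distrib)

lemma lift_coset:
  assumes "free.subspace M" "free.subspace N"
    and "\<And>p. p \<in> M \<Longrightarrow> lin_ext (\<lambda>x. rep (f x)) p \<in> N"
  shows "lift N f (coset M p) = coset N (lin_ext (\<lambda>x. rep (f x)) p)"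
  using assms(3)[OF rep_coset[OF assms(1), of p]]
  by (simp add: lift_def coset_eq_iff[OF assms(2)] lin_ext_diff)


section \<open>Tensor powers\<close>

locale tensor_powers = vector_space scale
  for scale :: "'k::field \<Rightarrow> 'a::ab_group_add \<Rightarrow> 'a" (infixr "*s" 75)
begin

text \<open>The relations of bilinearity and trilinearity; \<open>A \<otimes> A\<close> and \<open>A \<otimes> A \<otimes> A\<close> are the quotients of
  the free vector spaces on \<open>A \<times> A\<close> and \<open>A \<times> A \<times> A\<close> by the subspaces they span.\<close>

definition rels2 :: "('a \<times> 'a \<Rightarrow>\<^sub>0 'k) set" where
  "rels2 =
    {gen (x + x', y) - gen (x, y) - gen (x', y) | x x' y. True} \<union>
    {gen (x, y + y') - gen (x, y) - gen (x, y') | x y y'. True} \<union>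
    {gen (c *s x, y) - fscale c (gen (x, y)) | c x y. True} \<union>
    {gen (x, c *s y) - fscale c (gen (x, y)) | c x y. True}"

definition rels3 :: "('a \<times> 'a \<times> 'a \<Rightarrow>\<^sub>0 'k) set" where
  "rels3 =
    {gen (x + x', y, z) - gen (x, y, z) - gen (x', y, z) | x x' y z. True} \<union>
    {gen (x, y + y', z) - gen (x, y, z) - gen (x, y', z) | x y y' z. True} \<union>
    {gen (x, y, z + z') - gen (x, y, z) - gen (x, y, z') | x y z z'. True} \<union>
    {gen (c *s x, y, z) - fscale c (gen (x, y, z)) | c x y z. True} \<union>
    {gen (x, c *s y, z) - fscale c (gen (x, y, z)) | c x y z. True} \<union>
    {gen (x, y, c *s z) - fscale c (gen (x, y, z)) | c x y z. True}"

definition N2 :: "('a \<times> 'a \<Rightarrow>\<^sub>0 'k) set" where "N2 = free.span rels2"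
definition N3 :: "('a \<times> 'a \<times> 'a \<Rightarrow>\<^sub>0 'k) set" where "N3 = free.span rels3"

definition tensors2 :: "('a \<times> 'a \<Rightarrow>\<^sub>0 'k) set set" where "tensors2 = range (coset N2)"
definition tensors3 :: "('a \<times> 'a \<times> 'a \<Rightarrow>\<^sub>0 'k) set set" where "tensors3 = range (coset N3)"

definition pure2 :: "'a \<Rightarrow> 'a \<Rightarrow> ('a \<times> 'a \<Rightarrow>\<^sub>0 'k) set" where
  "pure2 x y = coset N2 (gen (x, y))"
definition pure3 :: "'a \<Rightarrow> 'a \<Rightarrow> 'a \<Rightarrow> ('a \<times> 'a \<times> 'a \<Rightarrow>\<^sub>0 'k) set" where
  "pure3 x y z = coset N3 (gen (x, y, z))"

abbreviation add2 (infixl "\<oplus>\<^sub>2" 65) where "add2 \<equiv> qadd N2"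
abbreviation minus2 (infixl "\<ominus>\<^sub>2" 65) where "minus2 \<equiv> qminus N2"
abbreviation add3 (infixl "\<oplus>\<^sub>3" 65) where "add3 \<equiv> qadd N3"
abbreviation minus3 (infixl "\<ominus>\<^sub>3" 65) where "minus3 \<equiv> qminus N3"

lemma subspace_N2: "free.subspace N2"
  by (simp add: N2_def)

lemma subspace_N3: "free.subspace N3"
  by (simp add: N3_def)

text \<open>The universal properties, which show that \<open>lift\<close> does not depend on representatives.\<close>

lemma lift_bilinear:
  assumes N: "free.subspace N"
    and mem: "\<And>x y. f (x, y) \<in> range (coset N)"
    and "\<And>x x' y. f (x + x', y) = qadd N (f (x, y)) (f (x', y))"
    and "\<And>x y y'. f (x, y + y') = qadd N (f (x, y)) (f (x, y'))"
    and "\<And>c x y. f (c *s x, y) = qscale N c (f (x, y))"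
    and "\<And>c x y. f (x, c *s y) = qscale N c (f (x, y))"
  shows "lift N f (pure2 x y) = f (x, y)"
    and "S \<in> tensors2 \<Longrightarrow> T \<in> tensors2 \<Longrightarrow> lift N f (S \<oplus>\<^sub>2 T) = qadd N (lift N f S) (lift N f T)"
    and "T \<in> tensors2 \<Longrightarrow> lift N f (qscale N2 c T) = qscale N c (lift N f T)"
proof -
  let ?F = "lin_ext (\<lambda>x. rep (f x))"
  interpret F: Vector_Spaces.linear fscale fscale ?F
    by (rule linear_lin_ext)
  have "N2 \<subseteq> {p. ?F p \<in> N}"
    unfolding N2_def
  proof (rule free.span_minimal)
    show "free.subspace {p. ?F p \<in> N}"
      using F.subspace_vimage[OF N] by (simp add: vimage_def)
    have A: "rep (qadd N s t) - rep s - rep t \<in> N" for s t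
      using rep_coset[OF N, of "rep s + rep t"] by (simp add: qadd_def diff_diff_eq)
    have B: "rep (qscale N c s) - fscale c (rep s) \<in> N" for c s
      using rep_coset[OF N] by (simp add: qscale_def)
    show "rels2 \<subseteq> {p. ?F p \<in> N}"
      unfolding rels2_def using assms(3-6) A B
      by (auto simp: F.diff F.scale)
  qed
  then have lc: "lift N f (coset N2 p) = coset N (?F p)" for p
    by (intro lift_coset subspace_N2 N) blast
  show "lift N f (pure2 x y) = f (x, y)"
    using coset_rep[OF N mem] by (simp add: pure2_def lc)
  show "S \<in> tensors2 \<Longrightarrow> T \<in> tensors2 \<Longrightarrow> lift N f (S \<oplus>\<^sub>2 T) = qadd N (lift N f S) (lift N f T)"
    by (auto simp: tensors2_def lc qadd_coset N subspace_N2 F.add)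
  show "T \<in> tensors2 \<Longrightarrow> lift N f (qscale N2 c T) = qscale N c (lift N f T)"
    by (auto simp: tensors2_def lc qscale_coset N subspace_N2 F.scale)
qed

lemma lift_trilinear:
  assumes N: "free.subspace N"
    and mem: "\<And>x y z. f (x, y, z) \<in> range (coset N)"
    and "\<And>x x' y z. f (x + x', y, z) = qadd N (f (x, y, z)) (f (x', y, z))"
    and "\<And>x y y' z. f (x, y + y', z) = qadd N (f (x, y, z)) (f (x, y', z))"
    and "\<And>x y z z'. f (x, y, z + z') = qadd N (f (x, y, z)) (f (x, y, z'))"
    and "\<And>c x y z. f (c *s x, y, z) = qscale N c (f (x, y, z))"
    and "\<And>c x y z. f (x, c *s y, z) = qscale N c (f (x, y, z))"
    and "\<And>c x y z. f (x, y, c *s z) = qscale N c (f (x, y, z))"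
  shows "lift N f (pure3 x y z) = f (x, y, z)"
    and "S \<in> tensors3 \<Longrightarrow> T \<in> tensors3 \<Longrightarrow> lift N f (S \<oplus>\<^sub>3 T) = qadd N (lift N f S) (lift N f T)"
    and "T \<in> tensors3 \<Longrightarrow> lift N f (qscale N3 c T) = qscale N c (lift N f T)"
proof -
  let ?F = "lin_ext (\<lambda>x. rep (f x))"
  interpret F: Vector_Spaces.linear fscale fscale ?F
    by (rule linear_lin_ext)
  have "N3 \<subseteq> {p. ?F p \<in> N}"
    unfolding N3_def
  proof (rule free.span_minimal)
    show "free.subspace {p. ?F p \<in> N}"
      using F.subspace_vimage[OF N] by (simp add: vimage_def)
    have A: "rep (qadd N s t) - rep s - rep t \<in> N" for s t
      using rep_coset[OF N, of "rep s + rep t"] by (simp add: qadd_def diff_diff_eq)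
    have B: "rep (qscale N c s) - fscale c (rep s) \<in> N" for c s
      using rep_coset[OF N] by (simp add: qscale_def)
    show "rels3 \<subseteq> {p. ?F p \<in> N}"
      unfolding rels3_def using assms(3-8) A B
      by (auto simp: F.diff F.scale)
  qed
  then have lc: "lift N f (coset N3 p) = coset N (?F p)" for p
    by (intro lift_coset subspace_N3 N) blast
  show "lift N f (pure3 x y z) = f (x, y, z)"
    using coset_rep[OF N mem] by (simp add: pure3_def lc)
  show "S \<in> tensors3 \<Longrightarrow> T \<in> tensors3 \<Longrightarrow> lift N f (S \<oplus>\<^sub>3 T) = qadd N (lift N f S) (lift N f T)"
    by (auto simp: tensors3_def lc qadd_coset N subspace_N3 F.add)
  show "T \<in> tensors3 \<Longrightarrow> lift N f (qscale N3 c T) = qscale N c (lift N f T)"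
    by (auto simp: tensors3_def lc qscale_coset N subspace_N3 F.scale)
qed

definition linear_tensor2 :: "('a \<Rightarrow> ('a \<times> 'a \<Rightarrow>\<^sub>0 'k) set) \<Rightarrow> bool" where
  "linear_tensor2 D \<longleftrightarrow>
    (\<forall>x. D x \<in> tensors2) \<and>
    (\<forall>x y. D (x + y) = D x \<oplus>\<^sub>2 D y) \<and>
    (\<forall>c x. D (c *s x) = qscale N2 c (D x))"

text \<open>A linear map \<open>A \<otimes> A \<rightarrow> A\<close> is given as the corresponding bilinear map in curried form.\<close>

definition bilinear_op :: "('a \<Rightarrow> 'a \<Rightarrow> 'a) \<Rightarrow> bool" where
  "bilinear_op m \<longleftrightarrow>
    (\<forall>x. Vector_Spaces.linear scale scale (m x)) \<and>
    (\<forall>y. Vector_Spaces.linear scale scale (\<lambda>x. m x y))"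

definition twist :: "('a \<times> 'a \<Rightarrow>\<^sub>0 'k) set \<Rightarrow> ('a \<times> 'a \<Rightarrow>\<^sub>0 'k) set" where
  "twist = lift N2 (\<lambda>(x, y). pure2 y x)"

definition cyc :: "('a \<times> 'a \<times> 'a \<Rightarrow>\<^sub>0 'k) set \<Rightarrow> ('a \<times> 'a \<times> 'a \<Rightarrow>\<^sub>0 'k) set" where
  "cyc = lift N3 (\<lambda>(x, y, z). pure3 z x y)"

text \<open>\<open>(Id - \<tau>) \<circ> D\<close>\<close>

definition cocommutator ::
  "('a \<Rightarrow> ('a \<times> 'a \<Rightarrow>\<^sub>0 'k) set) \<Rightarrow> 'a \<Rightarrow> ('a \<times> 'a \<Rightarrow>\<^sub>0 'k) set" where
  "cocommutator D x = D x \<ominus>\<^sub>2 twist (D x)"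

definition anti_symmetric :: "('a \<times> 'a \<Rightarrow>\<^sub>0 'k) set \<Rightarrow> bool" where
  "anti_symmetric r \<longleftrightarrow> twist r = quminus N2 r"

definition map_tensor2 :: "('a \<Rightarrow> 'a) \<Rightarrow> ('a \<times> 'a \<Rightarrow>\<^sub>0 'k) set \<Rightarrow> ('a \<times> 'a \<Rightarrow>\<^sub>0 'k) set" where
  "map_tensor2 \<alpha> = lift N2 (\<lambda>(x, y). pure2 (\<alpha> x) (\<alpha> y))"

text \<open>\<open>map_left \<alpha> D\<close> is \<open>\<alpha> \<otimes> D\<close> and \<open>map_right D \<alpha>\<close> is \<open>D \<otimes> \<alpha>\<close>, as maps \<open>A \<otimes> A \<rightarrow> A \<otimes> A \<otimes> A\<close>.\<close>

definition map_left ::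
  "('a \<Rightarrow> 'a) \<Rightarrow> ('a \<Rightarrow> ('a \<times> 'a \<Rightarrow>\<^sub>0 'k) set) \<Rightarrow> ('a \<times> 'a \<Rightarrow>\<^sub>0 'k) set \<Rightarrow> ('a \<times> 'a \<times> 'a \<Rightarrow>\<^sub>0 'k) set"
  where "map_left \<alpha> D = lift N3 (\<lambda>(x, y). lift N3 (\<lambda>(u, v). pure3 (\<alpha> x) u v) (D y))"

definition map_right ::
  "('a \<Rightarrow> ('a \<times> 'a \<Rightarrow>\<^sub>0 'k) set) \<Rightarrow> ('a \<Rightarrow> 'a) \<Rightarrow> ('a \<times> 'a \<Rightarrow>\<^sub>0 'k) set \<Rightarrow> ('a \<times> 'a \<times> 'a \<Rightarrow>\<^sub>0 'k) set"
  where "map_right D \<alpha> = lift N3 (\<lambda>(x, y). lift N3 (\<lambda>(u, v). pure3 u v (\<alpha> y)) (D x))"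

text \<open>The sum \<open>\<Sum>i,j. f u\<^sub>i v\<^sub>i u\<^sub>j v\<^sub>j\<close> in \<open>A \<otimes> A \<otimes> A\<close>, where \<open>r = \<Sum>i. u\<^sub>i \<otimes> v\<^sub>i\<close>.\<close>

definition double_sum ::
  "('a \<Rightarrow> 'a \<Rightarrow> 'a \<Rightarrow> 'a \<Rightarrow> ('a \<times> 'a \<times> 'a \<Rightarrow>\<^sub>0 'k) set) \<Rightarrow> ('a \<times> 'a \<Rightarrow>\<^sub>0 'k) set
    \<Rightarrow> ('a \<times> 'a \<times> 'a \<Rightarrow>\<^sub>0 'k) set" where
  "double_sum f r = lift N3 (\<lambda>(ui, vi). lift N3 (\<lambda>(uj, vj). f ui vi uj vj) r) r"


section \<open>Brackets with a 2-tensor and Yang-Baxter equations\<close>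

definition star_bracket ::
  "('a \<Rightarrow> 'a \<Rightarrow> 'a) \<Rightarrow> ('a \<Rightarrow> 'a) \<Rightarrow> 'a \<Rightarrow> ('a \<times> 'a \<Rightarrow>\<^sub>0 'k) set \<Rightarrow> ('a \<times> 'a \<Rightarrow>\<^sub>0 'k) set" where
  "star_bracket \<mu> \<alpha> a = lift N2 (\<lambda>(u, v). pure2 (\<mu> a u) (\<alpha> v) \<ominus>\<^sub>2 pure2 (\<alpha> u) (\<mu> v a))"

definition AYB ::
  "('a \<Rightarrow> 'a \<Rightarrow> 'a) \<Rightarrow> ('a \<Rightarrow> 'a) \<Rightarrow> ('a \<times> 'a \<Rightarrow>\<^sub>0 'k) set \<Rightarrow> ('a \<times> 'a \<times> 'a \<Rightarrow>\<^sub>0 'k) set" where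
  "AYB \<mu> \<alpha> r =
    double_sum (\<lambda>ui vi uj vj. pure3 (\<mu> ui uj) (\<alpha> vj) (\<alpha> vi)) r
    \<ominus>\<^sub>3 double_sum (\<lambda>ui vi uj vj. pure3 (\<alpha> ui) (\<mu> vi uj) (\<alpha> vj)) r
    \<oplus>\<^sub>3 double_sum (\<lambda>ui vi uj vj. pure3 (\<alpha> uj) (\<alpha> ui) (\<mu> vi vj)) r"

definition ad ::
  "('a \<Rightarrow> 'a \<Rightarrow> 'a) \<Rightarrow> ('a \<Rightarrow> 'a) \<Rightarrow> 'a \<Rightarrow> ('a \<times> 'a \<Rightarrow>\<^sub>0 'k) set \<Rightarrow> ('a \<times> 'a \<Rightarrow>\<^sub>0 'k) set" where
  "ad br \<alpha> x = lift N2 (\<lambda>(y1, y2). pure2 (br x y1) (\<alpha> y2) \<oplus>\<^sub>2 pure2 (\<alpha> y1) (br x y2))"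

definition CYB ::
  "('a \<Rightarrow> 'a \<Rightarrow> 'a) \<Rightarrow> ('a \<Rightarrow> 'a) \<Rightarrow> ('a \<times> 'a \<Rightarrow>\<^sub>0 'k) set \<Rightarrow> ('a \<times> 'a \<times> 'a \<Rightarrow>\<^sub>0 'k) set" where
  "CYB br \<alpha> r =
    double_sum (\<lambda>ui vi uj vj. pure3 (br ui uj) (\<alpha> vi) (\<alpha> vj)) r
    \<oplus>\<^sub>3 double_sum (\<lambda>ui vi uj vj. pure3 (\<alpha> ui) (br vi uj) (\<alpha> vj)) r
    \<oplus>\<^sub>3 double_sum (\<lambda>ui vi uj vj. pure3 (\<alpha> ui) (\<alpha> uj) (br vi vj)) r"

end


section \<open>Infinitesimal Hom-bialgebras\<close>

text \<open>In the last axiom the two summands are \<open>(\<mu> \<otimes> \<alpha>)(\<alpha> x \<otimes> \<Delta> y)\<close> and \<open>(\<alpha> \<otimes> \<mu>)(\<Delta> x \<otimes> \<alpha> y)\<close>.\<close>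

locale eps_hom_bialgebra = tensor_powers scale
  for scale :: "'k::field_char_0 \<Rightarrow> 'a::ab_group_add \<Rightarrow> 'a" +
  fixes \<mu> :: "'a \<Rightarrow> 'a \<Rightarrow> 'a"
    and \<Delta> :: "'a \<Rightarrow> ('a \<times> 'a \<Rightarrow>\<^sub>0 'k) set"
    and \<alpha> :: "'a \<Rightarrow> 'a"
  assumes bilinear_mult: "bilinear_op \<mu>"
    and linear_comult: "linear_tensor2 \<Delta>"
    and linear_twist: "Vector_Spaces.linear scale scale \<alpha>"
    and mult_twist: "\<alpha> (\<mu> x y) = \<mu> (\<alpha> x) (\<alpha> y)"
    and hom_assoc: "\<mu> (\<alpha> x) (\<mu> y z) = \<mu> (\<mu> x y) (\<alpha> z)"
    and comult_twist: "map_tensor2 \<alpha> (\<Delta> x) = \<Delta> (\<alpha> x)"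
    and hom_coassoc: "map_left \<alpha> \<Delta> (\<Delta> x) = map_right \<Delta> \<alpha> (\<Delta> x)"
    and compatibility: "\<Delta> (\<mu> x y) =
      lift N2 (\<lambda>(u, v). pure2 (\<mu> (\<alpha> x) u) (\<alpha> v)) (\<Delta> y)
      \<oplus>\<^sub>2 lift N2 (\<lambda>(u, v). pure2 (\<alpha> u) (\<mu> v (\<alpha> y))) (\<Delta> x)"

locale coboundary_eps_hom_bialgebra = eps_hom_bialgebra scale \<mu> \<Delta> \<alpha>
  for scale :: "'k::field_char_0 \<Rightarrow> 'a::ab_group_add \<Rightarrow> 'a" and \<mu> \<Delta> \<alpha> +
  fixes r :: "('a \<times> 'a \<Rightarrow>\<^sub>0 'k) set"
  assumes r_tensor: "r \<in> tensors2"
    and r_invariant: "map_tensor2 \<alpha> r = r"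
    and coboundary: "\<Delta> a = star_bracket \<mu> \<alpha> a r"

locale quasi_triangular_eps_hom_bialgebra = coboundary_eps_hom_bialgebra scale \<mu> \<Delta> \<alpha> r
  for scale :: "'k::field_char_0 \<Rightarrow> 'a::ab_group_add \<Rightarrow> 'a" and \<mu> \<Delta> \<alpha> r +
  assumes AYB_zero: "AYB \<mu> \<alpha> r = qzero N3"


section \<open>Hom-Lie bialgebras\<close>

locale hom_lie_algebra = tensor_powers scale
  for scale :: "'k::field_char_0 \<Rightarrow> 'a::ab_group_add \<Rightarrow> 'a" +
  fixes br :: "'a \<Rightarrow> 'a \<Rightarrow> 'a"
    and \<alpha> :: "'a \<Rightarrow> 'a"
  assumes bilinear_bracket: "bilinear_op br"
    and linear_twist: "Vector_Spaces.linear scale scale \<alpha>"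
    and bracket_anti_symmetric: "br x y = - br y x"
    and bracket_twist: "\<alpha> (br x y) = br (\<alpha> x) (\<alpha> y)"
    and hom_jacobi: "br (br x y) (\<alpha> z) + br (br z x) (\<alpha> y) + br (br y z) (\<alpha> x) = 0"

locale hom_lie_coalgebra = tensor_powers scale
  for scale :: "'k::field_char_0 \<Rightarrow> 'a::ab_group_add \<Rightarrow> 'a" +
  fixes \<delta> :: "'a \<Rightarrow> ('a \<times> 'a \<Rightarrow>\<^sub>0 'k) set"
    and \<alpha> :: "'a \<Rightarrow> 'a"
  assumes linear_cobracket: "linear_tensor2 \<delta>"
    and linear_cotwist: "Vector_Spaces.linear scale scale \<alpha>"
    and cobracket_twist: "\<delta> (\<alpha> x) = map_tensor2 \<alpha> (\<delta> x)"
    and cobracket_anti_symmetric: "anti_symmetric (\<delta> x)"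
    and hom_cojacobi: "map_left \<alpha> \<delta> (\<delta> x) \<oplus>\<^sub>3 cyc (map_left \<alpha> \<delta> (\<delta> x))
      \<oplus>\<^sub>3 cyc (cyc (map_left \<alpha> \<delta> (\<delta> x))) = qzero N3"

locale hom_lie_bialgebra = hom_lie_algebra scale br \<alpha> + hom_lie_coalgebra scale \<delta> \<alpha>
  for scale :: "'k::field_char_0 \<Rightarrow> 'a::ab_group_add \<Rightarrow> 'a" and br \<delta> \<alpha> +
  assumes bracket_cobracket: "\<delta> (br x y) = ad br \<alpha> (\<alpha> x) (\<delta> y) \<ominus>\<^sub>2 ad br \<alpha> (\<alpha> y) (\<delta> x)"

locale coboundary_hom_lie_bialgebra = hom_lie_bialgebra scale br \<delta> \<alpha>
  for scale :: "'k::field_char_0 \<Rightarrow> 'a::ab_group_add \<Rightarrow> 'a" and br \<delta> \<alpha> +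
  fixes r :: "('a \<times> 'a \<Rightarrow>\<^sub>0 'k) set"
  assumes r_tensor: "r \<in> tensors2"
    and r_invariant: "map_tensor2 \<alpha> r = r"
    and coboundary: "\<delta> x = ad br \<alpha> x r"

locale quasi_triangular_hom_lie_bialgebra = coboundary_hom_lie_bialgebra scale br \<delta> \<alpha> r
  for scale :: "'k::field_char_0 \<Rightarrow> 'a::ab_group_add \<Rightarrow> 'a" and br \<delta> \<alpha> r +
  assumes CYB_zero: "CYB br \<alpha> r = qzero N3"

end

theory Submission
  imports Defs
begin

text \<open>Over a field, two tensors are equal as soon as all bilinear (trilinear) forms take the same
  values on them, so every identity between tensors becomes an identity between finite sums of
  scalars. The co-Jacobi identity is then the coassociativity of \<open>\<Delta>\<close>, summed over the signed
  permutations of a trilinear form. Exchanging the two legs of \<open>r\<close> costs a sign; applied to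
  \<open>\<tau> \<circ> \<Delta>\<close> with \<open>\<Delta> = [-, r]\<^sub>*\<close>, this gives \<open>\<delta> = ad(r)\<close> and cancels the terms that obstruct
  the compatibility of bracket and cobracket. Finally \<open>-C(r)\<close> is \<open>A(r)\<close> minus its image under
  \<open>x \<otimes> y \<otimes> z \<mapsto> z \<otimes> y \<otimes> x\<close>, because both legs of both copies of \<open>r\<close> can be exchanged at once
  without a sign.\<close>

section \<open>Functionals on quotients of free vector spaces\<close>

text \<open>The functional with prescribed values on the generators: the counterpart of
  \<open>lin_ext\<close> whose target is the field of scalars.\<close>

definition ev :: "('x \<Rightarrow> 'k::field) \<Rightarrow> ('x \<Rightarrow>\<^sub>0 'k) \<Rightarrow> 'k" where
  "ev \<psi> p = (\<Sum>x\<in>Poly_Mapping.keys p. Poly_Mapping.lookup p x * \<psi> x)"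

lemma ev_superset:
  assumes "finite S" "Poly_Mapping.keys p \<subseteq> S"
  shows "ev \<psi> p = (\<Sum>x\<in>S. Poly_Mapping.lookup p x * \<psi> x)"
  unfolding ev_def using assms
  by (intro sum.mono_neutral_left) (auto simp: in_keys_iff)

lemma ev_add: "ev \<psi> (p + q) = ev \<psi> p + ev \<psi> q"
proof -
  let ?S = "Poly_Mapping.keys p \<union> Poly_Mapping.keys q"
  have "Poly_Mapping.keys (p + q) \<subseteq> ?S"
    by (rule Poly_Mapping.keys_add)
  then show ?thesis
    by (simp add: ev_superset[of ?S] lookup_add distrib_right sum.distrib)
qed

lemma ev_scale: "ev \<psi> (fscale c p) = c * ev \<psi> p"
proof -
  have "Poly_Mapping.keys (fscale c p) \<subseteq> Poly_Mapping.keys p"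
    by (auto simp: in_keys_iff)
  then show ?thesis
    by (simp add: ev_superset[of "Poly_Mapping.keys p"] sum_distrib_left mult.assoc)
qed

text \<open>The field is taken as a vector space over itself, so that facts on spans and on
  extension from independent sets apply to functionals.\<close>

interpretation free_functional: vector_space_pair fscale "(*) :: 'k::field \<Rightarrow> 'k \<Rightarrow> 'k"
  by unfold_locales (auto simp: algebra_simps)

lemma linear_ev: "Vector_Spaces.linear fscale (*) (ev \<psi>)"
  by unfold_locales (simp_all add: ev_add ev_scale)

lemmas ev_diff = module_hom.diff[OF Vector_Spaces.linear.axioms(3)[OF linear_ev]]
lemmas ev_neg = module_hom.neg[OF Vector_Spaces.linear.axioms(3)[OF linear_ev]]
lemmas ev_zero = module_hom.zero[OF Vector_Spaces.linear.axioms(3)[OF linear_ev]]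
lemmas ev_sum = module_hom.sum[OF Vector_Spaces.linear.axioms(3)[OF linear_ev]]

lemma ev_gen [simp]: "ev \<psi> (gen x) = \<psi> x"
  by (simp add: ev_def gen_def)

lemma ev_lin_ext: "ev \<psi> (lin_ext f p) = ev (\<lambda>x. ev \<psi> (f x)) p"
  by (simp add: lin_ext_def ev_sum ev_scale ev_def[of _ p])

lemma poly_mapping_eq_sum_gen:
  "p = (\<Sum>x\<in>Poly_Mapping.keys p. fscale (Poly_Mapping.lookup p x) (gen x))"
  by (rule poly_mapping_eqI) (auto simp: lookup_sum gen_def lookup_single when_def in_keys_iff
      if_distrib sum.delta cong: if_cong)

text \<open>A linear map is determined by its values on generators. This brings a functional
  obtained by abstract extension into the form \<open>ev\<close>.\<close>

lemma linear_functional_eq_ev: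
  assumes "Vector_Spaces.linear fscale (*) g"
  shows "g = ev (\<lambda>x. g (gen x))"
proof
  fix p
  interpret g: Vector_Spaces.linear fscale "(*)" g by fact
  show "g p = ev (\<lambda>x. g (gen x)) p"
    by (subst poly_mapping_eq_sum_gen) (simp add: g.sum g.scale ev_def)
qed

section \<open>Functionals that kill a subspace\<close>

definition vanishes_on :: "('x \<Rightarrow>\<^sub>0 'k::field) set \<Rightarrow> ('x \<Rightarrow> 'k) \<Rightarrow> bool" where
  "vanishes_on N \<psi> \<longleftrightarrow> (\<forall>p\<in>N. ev \<psi> p = 0)"

lemma vanishes_on_span:
  assumes "\<And>p. p \<in> S \<Longrightarrow> ev \<psi> p = 0"
  shows "vanishes_on (free.span S) \<psi>"
  unfolding vanishes_on_def
  using free_functional.linear_eq_0_on_span[OF linear_ev assms] by blast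

text \<open>A basis of \<open>N\<close> stays independent when \<open>p\<close> is added, so a
  functional may be prescribed to be 0 on that basis and 1 at \<open>p\<close>.\<close>

lemma separating_functional:
  assumes N: "free.subspace N" and p: "p \<notin> N"
  obtains \<psi> where "vanishes_on N \<psi>" "ev \<psi> p \<noteq> 0"
proof -
  obtain B where B: "B \<subseteq> N" "free.independent B" "N \<subseteq> free.span B"
    using free.maximal_independent_subset[of N] by blast
  have span: "free.span B = N"
    using B free.span_minimal[OF B(1) N] by blast
  have "free.independent (insert p B)"
    using B p span by (intro free.independent_insertI) auto
  then obtain g where g: "Vector_Spaces.linear fscale (*) g"
      "\<forall>x\<in>insert p B. g x = (if x = p then 1 else 0)"
    using free_functional.linear_independent_extend[of "insert p B" "\<lambda>x. if x = p then 1 else 0"]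
    by blast
  have "g q = 0" if "q \<in> N" for q
  proof (rule free_functional.linear_eq_0_on_span[OF g(1)])
    show "g x = 0" if "x \<in> B" for x
      using that g(2) B(1) p by auto
  qed (use that span in simp)
  moreover have "g p = 1"
    using g(2) by simp
  ultimately show thesis
    using that[of "\<lambda>x. g (gen x)"] linear_functional_eq_ev[OF g(1)]
    by (simp add: vanishes_on_def)
qed

text \<open>The choice made by \<open>rep\<close> keeps this total. It is the functional induced on
  the quotient once \<psi> vanishes on the subspace that is factored out.\<close>

definition eval :: "('x \<Rightarrow> 'k::field) \<Rightarrow> ('x \<Rightarrow>\<^sub>0 'k) set \<Rightarrow> 'k" where
  "eval \<psi> T = ev \<psi> (rep T)"

lemma eval_coset:
  assumes "free.subspace N" "vanishes_on N \<psi>"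
  shows "eval \<psi> (coset N p) = ev \<psi> p"
  using assms(2) rep_coset[OF assms(1), of p]
  by (auto simp: eval_def vanishes_on_def ev_diff)

text \<open>The duality behind all later equalities: if the difference of two representatives lay
  outside \<open>N\<close>, a functional vanishing on \<open>N\<close> would detect it.\<close>

lemma eval_eqI:
  assumes N: "free.subspace N" and "S \<in> range (coset N)" "T \<in> range (coset N)"
    and eq: "\<And>\<psi>. vanishes_on N \<psi> \<Longrightarrow> eval \<psi> S = eval \<psi> T"
  shows "S = T"
proof -
  obtain p q where pq: "S = coset N p" "T = coset N q"
    using assms by blast
  have "p - q \<in> N"
  proof (rule ccontr)
    assume "p - q \<notin> N"
    then obtain \<psi> where \<psi>: "vanishes_on N \<psi>" "ev \<psi> (p - q) \<noteq> 0"
      using separating_functional[OF N] by blast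
    then show False
      using eq[OF \<psi>(1)] by (simp add: pq eval_coset[OF N \<psi>(1)] ev_diff)
  qed
  then show ?thesis
    by (simp add: pq coset_eq_iff[OF N])
qed

text \<open>This needs no compatibility of \<open>f\<close> with relations: both sides use the same representative
  of \<open>T\<close>.\<close>

lemma eval_lift:
  assumes "free.subspace N" "vanishes_on N \<psi>"
  shows "eval \<psi> (lift N f T) = eval (\<lambda>x. eval \<psi> (f x)) T"
  by (simp add: lift_def eval_coset[OF assms] ev_lin_ext) (simp add: eval_def)

lemma
  assumes "free.subspace N" "vanishes_on N \<psi>"
  shows eval_qadd: "eval \<psi> (qadd N S T) = eval \<psi> S + eval \<psi> T"
    and eval_qminus: "eval \<psi> (qminus N S T) = eval \<psi> S - eval \<psi> T"
    and eval_quminus: "eval \<psi> (quminus N T) = - eval \<psi> T"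
    and eval_qscale: "eval \<psi> (qscale N c T) = c * eval \<psi> T"
    and eval_qzero: "eval \<psi> (qzero N) = 0"
  by (simp_all add: qadd_def qminus_def quminus_def qscale_def qzero_def eval_coset[OF assms]
      ev_add ev_diff ev_neg ev_scale ev_zero) (simp_all add: eval_def)

lemma quotient_operations_in_range:
  "qadd N S T \<in> range (coset N)" "qminus N S T \<in> range (coset N)"
  "quminus N T \<in> range (coset N)" "qscale N c T \<in> range (coset N)"
  "qzero N \<in> range (coset N)" "lift N f U \<in> range (coset N)"
  by (simp_all add: qadd_def qminus_def quminus_def qscale_def qzero_def lift_def)


section \<open>Bilinear and trilinear forms separate tensors\<close>

context tensor_powers
begin

definition bilinear_form :: "('a \<Rightarrow> 'a \<Rightarrow> 'k) \<Rightarrow> bool" where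
  "bilinear_form \<psi> \<longleftrightarrow>
    (\<forall>x x' y. \<psi> (x + x') y = \<psi> x y + \<psi> x' y) \<and>
    (\<forall>x y y'. \<psi> x (y + y') = \<psi> x y + \<psi> x y') \<and>
    (\<forall>c x y. \<psi> (c *s x) y = c * \<psi> x y) \<and>
    (\<forall>c x y. \<psi> x (c *s y) = c * \<psi> x y)"

definition trilinear_form :: "('a \<Rightarrow> 'a \<Rightarrow> 'a \<Rightarrow> 'k) \<Rightarrow> bool" where
  "trilinear_form \<phi> \<longleftrightarrow>
    (\<forall>x. bilinear_form (\<phi> x)) \<and>
    (\<forall>x x' y z. \<phi> (x + x') y z = \<phi> x y z + \<phi> x' y z) \<and>
    (\<forall>c x y z. \<phi> (c *s x) y z = c * \<phi> x y z)"

lemma bilinear_formD: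
  assumes "bilinear_form \<psi>"
  shows "\<psi> (x + x') y = \<psi> x y + \<psi> x' y" "\<psi> x (y + y') = \<psi> x y + \<psi> x y'"
    "\<psi> (x - x') y = \<psi> x y - \<psi> x' y" "\<psi> x (y - y') = \<psi> x y - \<psi> x y'"
    "\<psi> (c *s x) y = c * \<psi> x y" "\<psi> x (c *s y) = c * \<psi> x y"
proof -
  show add: "\<psi> (x + x') y = \<psi> x y + \<psi> x' y" "\<psi> x (y + y') = \<psi> x y + \<psi> x y'" for x x' y y'
    using assms by (auto simp: bilinear_form_def)
  show "\<psi> (x - x') y = \<psi> x y - \<psi> x' y" "\<psi> x (y - y') = \<psi> x y - \<psi> x y'"
    using add(1)[of "x - x'" x' y] add(2)[of x "y - y'" y'] by (simp_all add: algebra_simps)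
  show "\<psi> (c *s x) y = c * \<psi> x y" "\<psi> x (c *s y) = c * \<psi> x y"
    using assms by (auto simp: bilinear_form_def)
qed

lemma trilinear_formD:
  assumes "trilinear_form \<phi>"
  shows "\<phi> (x + x') y z = \<phi> x y z + \<phi> x' y z" "\<phi> x (y + y') z = \<phi> x y z + \<phi> x y' z"
    "\<phi> x y (z + z') = \<phi> x y z + \<phi> x y z'"
    "\<phi> (x - x') y z = \<phi> x y z - \<phi> x' y z" "\<phi> x (y - y') z = \<phi> x y z - \<phi> x y' z"
    "\<phi> x y (z - z') = \<phi> x y z - \<phi> x y z'"
    "\<phi> (c *s x) y z = c * \<phi> x y z" "\<phi> x (c *s y) z = c * \<phi> x y z"
    "\<phi> x y (c *s z) = c * \<phi> x y z"
proof -
  have bil: "bilinear_form (\<phi> x)" for x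
    using assms by (auto simp: trilinear_form_def)
  show add: "\<phi> (x + x') y z = \<phi> x y z + \<phi> x' y z" for x x'
    using assms by (auto simp: trilinear_form_def)
  show "\<phi> (x - x') y z = \<phi> x y z - \<phi> x' y z"
    using add[of "x - x'" x'] by (simp add: algebra_simps)
  show "\<phi> (c *s x) y z = c * \<phi> x y z"
    using assms by (auto simp: trilinear_form_def)
qed (use assms in \<open>auto simp: trilinear_form_def bilinear_formD\<close>)

text \<open>Permutations of tensor factors act on forms by permuting arguments, so facts about a
  form are also used for its rearrangements. The fifth one, the reversal, serves the Yang-Baxter
  equation.\<close>

lemma trilinear_form_perm:
  assumes "trilinear_form \<phi>"
  shows "trilinear_form (\<lambda>x y z. \<phi> x z y)" "trilinear_form (\<lambda>x y z. \<phi> y x z)"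
    "trilinear_form (\<lambda>x y z. \<phi> y z x)" "trilinear_form (\<lambda>x y z. \<phi> z x y)"
    "trilinear_form (\<lambda>x y z. \<phi> z y x)"
  using assms by (simp_all add: trilinear_form_def bilinear_form_def)

lemma bilinear_form_swap: "bilinear_form \<psi> \<Longrightarrow> bilinear_form (\<lambda>x y. \<psi> y x)"
  by (simp add: bilinear_form_def)

lemma bilinear_form_diff:
  assumes "bilinear_form \<psi>" "bilinear_form \<psi>'"
  shows "bilinear_form (\<lambda>x y. \<psi> x y - \<psi>' x y)"
  using bilinear_formD[OF assms(1)] bilinear_formD[OF assms(2)]
  by (simp add: bilinear_form_def right_diff_distrib)

text \<open>The value of \<open>ev\<close> on a relation is the defect of additivity or homogeneity
  of \<psi> in one argument, and a functional that kills all relations kills their span.\<close>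

lemma vanishes_on_N2_iff: "vanishes_on N2 \<psi> \<longleftrightarrow> bilinear_form (\<lambda>x y. \<psi> (x, y))"
proof
  assume "vanishes_on N2 \<psi>"
  then have "ev \<psi> p = 0" if "p \<in> rels2" for p
    using that by (simp add: vanishes_on_def N2_def free.span_base)
  note * = this[unfolded rels2_def]
  \<comment> \<open>The last two rules read \<open>a - b - c = 0\<close> as
    \<open>a = b + c\<close>, which turns vanishing on a relation into a law of additivity or
    homogeneity.\<close>
  note ev_expand = ev_add ev_diff ev_scale ev_gen diff_diff_eq right_minus_eq
  have 1: "ev \<psi> (gen (x + x', y) - gen (x, y) - gen (x', y)) = 0" for x x' y
    by (rule *) blast
  have 2: "ev \<psi> (gen (x, y + y') - gen (x, y) - gen (x, y')) = 0" for x y y'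
    by (rule *) blast
  have 3: "ev \<psi> (gen (c *s x, y) - fscale c (gen (x, y))) = 0" for c x y
    by (rule *) blast
  have 4: "ev \<psi> (gen (x, c *s y) - fscale c (gen (x, y))) = 0" for c x y
    by (rule *) blast
  show "bilinear_form (\<lambda>x y. \<psi> (x, y))"
    using 1 2 3 4 unfolding bilinear_form_def ev_expand by blast
next
  assume "bilinear_form (\<lambda>x y. \<psi> (x, y))"
  then show "vanishes_on N2 \<psi>"
    unfolding N2_def
    by (intro vanishes_on_span) (auto simp: rels2_def bilinear_form_def ev_diff ev_scale)
qed

lemma vanishes_on_N3_iff: "vanishes_on N3 \<phi> \<longleftrightarrow> trilinear_form (\<lambda>x y z. \<phi> (x, y, z))"
proof
  assume "vanishes_on N3 \<phi>"
  then have "ev \<phi> p = 0" if "p \<in> rels3" for p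
    using that by (simp add: vanishes_on_def N3_def free.span_base)
  note * = this[unfolded rels3_def]
  note ev_expand = ev_add ev_diff ev_scale ev_gen diff_diff_eq right_minus_eq
  have 1: "ev \<phi> (gen (x + x', y, z) - gen (x, y, z) - gen (x', y, z)) = 0" for x x' y z
    by (rule *) fast
  have 2: "ev \<phi> (gen (x, y + y', z) - gen (x, y, z) - gen (x, y', z)) = 0" for x y y' z
    by (rule *) blast
  have 3: "ev \<phi> (gen (x, y, z + z') - gen (x, y, z) - gen (x, y, z')) = 0" for x y z z'
    by (rule *) blast
  have 4: "ev \<phi> (gen (c *s x, y, z) - fscale c (gen (x, y, z))) = 0" for c x y z
    by (rule *) blast
  have 5: "ev \<phi> (gen (x, c *s y, z) - fscale c (gen (x, y, z))) = 0" for c x y z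
    by (rule *) blast
  have 6: "ev \<phi> (gen (x, y, c *s z) - fscale c (gen (x, y, z))) = 0" for c x y z
    by (rule *) blast
  show "trilinear_form (\<lambda>x y z. \<phi> (x, y, z))"
    using 1 2 3 4 5 6 unfolding trilinear_form_def bilinear_form_def ev_expand
    by (intro conjI allI)
next
  assume "trilinear_form (\<lambda>x y z. \<phi> (x, y, z))"
  then show "vanishes_on N3 \<phi>"
    unfolding N3_def
    by (intro vanishes_on_span)
      (auto simp: rels3_def trilinear_form_def bilinear_form_def ev_diff ev_scale)
qed

text \<open>For an arbitrary function this is a weighted sum over one representative; for a bilinear
  form it is the induced functional on the tensor square.\<close>

definition eval2 :: "('a \<Rightarrow> 'a \<Rightarrow> 'k) \<Rightarrow> ('a \<times> 'a \<Rightarrow>\<^sub>0 'k) set \<Rightarrow> 'k" where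
  "eval2 \<psi> = eval (\<lambda>(x, y). \<psi> x y)"

definition eval3 :: "('a \<Rightarrow> 'a \<Rightarrow> 'a \<Rightarrow> 'k) \<Rightarrow> ('a \<times> 'a \<times> 'a \<Rightarrow>\<^sub>0 'k) set \<Rightarrow> 'k" where
  "eval3 \<phi> = eval (\<lambda>(x, y, z). \<phi> x y z)"

lemma eval2_eqI:
  assumes "S \<in> tensors2" "T \<in> tensors2"
    and "\<And>\<psi>. bilinear_form \<psi> \<Longrightarrow> eval2 \<psi> S = eval2 \<psi> T"
  shows "S = T"
proof (rule eval_eqI[OF subspace_N2])
  fix \<psi> assume "vanishes_on N2 \<psi>"
  then show "eval \<psi> S = eval \<psi> T"
    using assms(3)[of "\<lambda>x y. \<psi> (x, y)"] by (simp add: vanishes_on_N2_iff eval2_def)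
qed (use assms in \<open>auto simp: tensors2_def\<close>)

lemma eval3_eqI:
  assumes "S \<in> tensors3" "T \<in> tensors3"
    and "\<And>\<phi>. trilinear_form \<phi> \<Longrightarrow> eval3 \<phi> S = eval3 \<phi> T"
  shows "S = T"
proof (rule eval_eqI[OF subspace_N3])
  fix \<phi> assume "vanishes_on N3 \<phi>"
  then show "eval \<phi> S = eval \<phi> T"
    using assms(3)[of "\<lambda>x y z. \<phi> (x, y, z)"] by (simp add: vanishes_on_N3_iff eval3_def)
qed (use assms in \<open>auto simp: tensors3_def\<close>)

lemma tensors2_closed:
  "qadd N2 S T \<in> tensors2" "qminus N2 S T \<in> tensors2" "quminus N2 T \<in> tensors2"
  "qscale N2 c T \<in> tensors2" "lift N2 f U \<in> tensors2"
  by (simp_all add: tensors2_def quotient_operations_in_range)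

lemma tensors3_closed:
  "qadd N3 S T \<in> tensors3" "qzero N3 \<in> tensors3"
  by (simp_all add: tensors3_def quotient_operations_in_range)

lemma
  assumes "bilinear_form \<psi>"
  shows eval2_pure2: "eval2 \<psi> (pure2 x y) = \<psi> x y"
    and eval2_qadd: "eval2 \<psi> (qadd N2 S T) = eval2 \<psi> S + eval2 \<psi> T"
    and eval2_qminus: "eval2 \<psi> (qminus N2 S T) = eval2 \<psi> S - eval2 \<psi> T"
    and eval2_quminus: "eval2 \<psi> (quminus N2 T) = - eval2 \<psi> T"
    and eval2_qscale: "eval2 \<psi> (qscale N2 c T) = c * eval2 \<psi> T"
    and eval2_lift: "eval2 \<psi> (lift N2 (\<lambda>(x, y). f x y) T) = eval2 (\<lambda>x y. eval2 \<psi> (f x y)) T"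
proof -
  have *: "vanishes_on N2 (\<lambda>(x, y). \<psi> x y)"
    using assms by (simp add: vanishes_on_N2_iff)
  note rules = eval_coset eval_qadd eval_qminus eval_quminus eval_qscale
  note [simp] = rules[OF subspace_N2 *]
  show "eval2 \<psi> (pure2 x y) = \<psi> x y"
    "eval2 \<psi> (qadd N2 S T) = eval2 \<psi> S + eval2 \<psi> T"
    "eval2 \<psi> (qminus N2 S T) = eval2 \<psi> S - eval2 \<psi> T"
    "eval2 \<psi> (quminus N2 T) = - eval2 \<psi> T"
    "eval2 \<psi> (qscale N2 c T) = c * eval2 \<psi> T"
    by (simp_all add: eval2_def pure2_def)
  show "eval2 \<psi> (lift N2 (\<lambda>(x, y). f x y) T) = eval2 (\<lambda>x y. eval2 \<psi> (f x y)) T"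
    unfolding eval2_def eval_lift[OF subspace_N2 *] by (simp add: case_prod_unfold)
qed

lemma
  assumes "trilinear_form \<phi>"
  shows eval3_pure3: "eval3 \<phi> (pure3 x y z) = \<phi> x y z"
    and eval3_qadd: "eval3 \<phi> (qadd N3 S T) = eval3 \<phi> S + eval3 \<phi> T"
    and eval3_qminus: "eval3 \<phi> (qminus N3 S T) = eval3 \<phi> S - eval3 \<phi> T"
    and eval3_qzero: "eval3 \<phi> (qzero N3) = 0"
    and eval3_lift2: "eval3 \<phi> (lift N3 (\<lambda>(x, y). f x y) R) = eval2 (\<lambda>x y. eval3 \<phi> (f x y)) R"
    and eval3_lift3: "eval3 \<phi> (lift N3 (\<lambda>(x, y, z). g x y z) T) =
      eval3 (\<lambda>x y z. eval3 \<phi> (g x y z)) T"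
proof -
  have *: "vanishes_on N3 (\<lambda>(x, y, z). \<phi> x y z)"
    using assms by (simp add: vanishes_on_N3_iff)
  note rules = eval_coset eval_qadd eval_qminus eval_qzero
  note [simp] = rules[OF subspace_N3 *]
  show "eval3 \<phi> (pure3 x y z) = \<phi> x y z"
    "eval3 \<phi> (qadd N3 S T) = eval3 \<phi> S + eval3 \<phi> T"
    "eval3 \<phi> (qminus N3 S T) = eval3 \<phi> S - eval3 \<phi> T"
    "eval3 \<phi> (qzero N3) = 0"
    by (simp_all add: eval3_def pure3_def)
  show "eval3 \<phi> (lift N3 (\<lambda>(x, y). f x y) R) = eval2 (\<lambda>x y. eval3 \<phi> (f x y)) R"
    "eval3 \<phi> (lift N3 (\<lambda>(x, y, z). g x y z) T) = eval3 (\<lambda>x y z. eval3 \<phi> (g x y z)) T"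
    unfolding eval2_def eval3_def eval_lift[OF subspace_N3 *] by (simp_all add: case_prod_unfold)
qed

lemma eval2_eq_sum:
  "eval2 f T = (\<Sum>p\<in>Poly_Mapping.keys (rep T). Poly_Mapping.lookup (rep T) p * f (fst p) (snd p))"
  by (simp add: eval2_def eval_def ev_def case_prod_unfold)

text \<open>All evaluations of \<open>T\<close> run over the same representative, so these are laws
  of finite sums for arbitrary \<open>f\<close> and \<open>g\<close>.\<close>

lemma eval2_linear:
  "eval2 (\<lambda>x y. f x y + g x y) T = eval2 f T + eval2 g T"
  "eval2 (\<lambda>x y. f x y - g x y) T = eval2 f T - eval2 g T"
  "eval2 (\<lambda>x y. - f x y) T = - eval2 f T"
  "eval2 (\<lambda>x y. c * f x y) T = c * eval2 f T"
  unfolding eval2_eq_sum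
  by (simp_all only: distrib_left right_diff_distrib mult_minus_right mult.left_commute[of _ c]
      sum.distrib sum_subtractf sum_negf flip: sum_distrib_left)

lemma eval2_commute:
  "eval2 (\<lambda>x y. eval2 (\<lambda>u v. f x y u v) S) T = eval2 (\<lambda>u v. eval2 (\<lambda>x y. f x y u v) T) S"
  unfolding eval2_eq_sum sum_distrib_left
  by (subst sum.swap) (simp only: mult.left_commute)

section \<open>Evaluation of the tensor operations\<close>

lemma eval2_twist: "bilinear_form \<psi> \<Longrightarrow> eval2 \<psi> (twist T) = eval2 (\<lambda>x y. \<psi> y x) T"
  by (simp add: twist_def eval2_lift eval2_pure2)

lemma eval2_map_tensor2:
  "bilinear_form \<psi> \<Longrightarrow> eval2 \<psi> (map_tensor2 f T) = eval2 (\<lambda>x y. \<psi> (f x) (f y)) T"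
  by (simp add: map_tensor2_def eval2_lift eval2_pure2)

lemma eval2_cocommutator:
  "bilinear_form \<psi> \<Longrightarrow>
    eval2 \<psi> (cocommutator D x) = eval2 \<psi> (D x) - eval2 (\<lambda>u v. \<psi> v u) (D x)"
  by (simp add: cocommutator_def eval2_qminus eval2_twist)

lemma eval3_cyc: "trilinear_form \<phi> \<Longrightarrow> eval3 \<phi> (cyc T) = eval3 (\<lambda>x y z. \<phi> z x y) T"
  by (simp add: cyc_def eval3_lift3 eval3_pure3)

lemma eval3_map_left:
  "trilinear_form \<phi> \<Longrightarrow>
    eval3 \<phi> (map_left f D T) = eval2 (\<lambda>x y. eval2 (\<lambda>u v. \<phi> (f x) u v) (D y)) T"
  by (simp add: map_left_def eval3_lift2 eval3_pure3)

lemma eval3_map_right: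
  "trilinear_form \<phi> \<Longrightarrow>
    eval3 \<phi> (map_right D f T) = eval2 (\<lambda>x y. eval2 (\<lambda>u v. \<phi> u v (f y)) (D x)) T"
  by (simp add: map_right_def eval3_lift2 eval3_pure3)

lemma eval3_double_sum:
  "trilinear_form \<phi> \<Longrightarrow>
    eval3 \<phi> (double_sum f r) = eval2 (\<lambda>u v. eval2 (\<lambda>u' v'. eval3 \<phi> (f u v u' v')) r) r"
  by (simp add: double_sum_def eval3_lift2)

lemma eval2_star_bracket:
  "bilinear_form \<psi> \<Longrightarrow> eval2 \<psi> (star_bracket m f a r) =
    eval2 (\<lambda>u v. \<psi> (m a u) (f v)) r - eval2 (\<lambda>u v. \<psi> (f u) (m v a)) r"
  by (simp add: star_bracket_def eval2_lift eval2_pure2 eval2_qminus eval2_linear)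

lemma eval2_ad:
  "bilinear_form \<psi> \<Longrightarrow> eval2 \<psi> (ad br f a r) =
    eval2 (\<lambda>u v. \<psi> (br a u) (f v)) r + eval2 (\<lambda>u v. \<psi> (f u) (br a v)) r"
  by (simp add: ad_def eval2_lift eval2_pure2 eval2_qadd eval2_linear)

section \<open>Exchanging the legs of an anti-symmetric tensor\<close>

lemma eval2_anti_symmetric:
  assumes "anti_symmetric r" "bilinear_form \<psi>"
  shows "eval2 (\<lambda>u v. \<psi> v u) r = - eval2 \<psi> r"
  using assms by (metis anti_symmetric_def eval2_twist eval2_quminus)

text \<open>Each copy of \<open>r\<close> contributes one sign, and the two signs cancel.\<close>

lemma eval2_eval2_anti_symmetric:
  assumes r: "anti_symmetric r"
    and 1: "\<And>u' v'. bilinear_form (\<lambda>u v. f u v u' v')"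
    and 2: "\<And>u v. bilinear_form (f u v)"
  shows "eval2 (\<lambda>u v. eval2 (\<lambda>u' v'. f v u v' u') r) r = eval2 (\<lambda>u v. eval2 (f u v) r) r"
proof -
  have "eval2 (\<lambda>u v. eval2 (\<lambda>u' v'. f v u v' u') r) r = eval2 (\<lambda>u v. - eval2 (f v u) r) r"
    by (simp add: eval2_anti_symmetric[OF r 2])
  \<comment> \<open>The sums are interchanged so that the pair whose legs are still to be exchanged
    becomes the inner one.\<close>
  also have "\<dots> = - eval2 (\<lambda>u' v'. eval2 (\<lambda>u v. f v u u' v') r) r"
    by (simp add: eval2_linear) (rule eval2_commute)
  also have "\<dots> = eval2 (\<lambda>u' v'. eval2 (\<lambda>u v. f u v u' v') r) r"
    by (simp add: eval2_anti_symmetric[OF r 1] eval2_linear)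
  also have "\<dots> = eval2 (\<lambda>u v. eval2 (f u v) r) r"
    by (rule eval2_commute)
  finally show ?thesis .
qed

lemma eval2_linear_tensor2:
  assumes "linear_tensor2 D" "bilinear_form \<psi>"
  shows "eval2 \<psi> (D (x + y)) = eval2 \<psi> (D x) + eval2 \<psi> (D y)"
    "eval2 \<psi> (D (x - y)) = eval2 \<psi> (D x) - eval2 \<psi> (D y)"
    "eval2 \<psi> (D (c *s x)) = c * eval2 \<psi> (D x)"
proof -
  show add: "eval2 \<psi> (D (x + y)) = eval2 \<psi> (D x) + eval2 \<psi> (D y)" for x y
    using assms by (simp add: linear_tensor2_def eval2_qadd)
  show "eval2 \<psi> (D (x - y)) = eval2 \<psi> (D x) - eval2 \<psi> (D y)"
    using add[of "x - y" y] by simp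
  show "eval2 \<psi> (D (c *s x)) = c * eval2 \<psi> (D x)"
    using assms by (simp add: linear_tensor2_def eval2_qscale)
qed

end


section \<open>The Hom-Lie bialgebra of commutators\<close>

context eps_hom_bialgebra
begin

lemma mult_linear:
  "\<mu> (x + y) z = \<mu> x z + \<mu> y z" "\<mu> z (x + y) = \<mu> z x + \<mu> z y"
  "\<mu> (x - y) z = \<mu> x z - \<mu> y z" "\<mu> z (x - y) = \<mu> z x - \<mu> z y"
  "\<mu> (scale c x) z = scale c (\<mu> x z)" "\<mu> z (scale c x) = scale c (\<mu> z x)"
proof -
  have right: "module_hom scale scale (\<mu> z)" and left: "module_hom scale scale (\<lambda>x. \<mu> x z)" for z
    using bilinear_mult by (auto simp: bilinear_op_def linear_iff_module_hom)
  show "\<mu> (x + y) z = \<mu> x z + \<mu> y z" "\<mu> (x - y) z = \<mu> x z - \<mu> y z"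
    "\<mu> (scale c x) z = scale c (\<mu> x z)"
    using module_hom.add[OF left] module_hom.diff[OF left] module_hom.scale[OF left] by blast+
  show "\<mu> z (x + y) = \<mu> z x + \<mu> z y" "\<mu> z (x - y) = \<mu> z x - \<mu> z y"
    "\<mu> z (scale c x) = scale c (\<mu> z x)"
    using module_hom.add[OF right] module_hom.diff[OF right] module_hom.scale[OF right] by blast+
qed

lemma twist_linear:
  "\<alpha> (x + y) = \<alpha> x + \<alpha> y" "\<alpha> (x - y) = \<alpha> x - \<alpha> y" "\<alpha> (scale c x) = scale c (\<alpha> x)"
  using linear_twist by (simp_all add: linear_iff_module_hom module_hom.add module_hom.diff module_hom.scale)

section \<open>The commutator bracket\<close>

lemma hom_lie_algebra_commutator: "hom_lie_algebra scale (\<lambda>x y. \<mu> x y - \<mu> y x) \<alpha>"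
proof (intro hom_lie_algebra.intro hom_lie_algebra_axioms.intro tensor_powers_axioms)
  show "bilinear_op (\<lambda>x y. \<mu> x y - \<mu> y x)"
    by (simp add: bilinear_op_def Vector_Spaces.linear_iff vector_space_axioms mult_linear scale_right_diff_distrib)
  show "Vector_Spaces.linear scale scale \<alpha>"
    by (rule linear_twist)
  show "\<mu> x y - \<mu> y x = - (\<mu> y x - \<mu> x y)" for x y
    by simp
  show "\<alpha> (\<mu> x y - \<mu> y x) = \<mu> (\<alpha> x) (\<alpha> y) - \<mu> (\<alpha> y) (\<alpha> x)" for x y
    by (simp add: twist_linear mult_twist)
  \<comment> \<open>Expansion gives twelve products. Hom-associativity brings each into the form
    \<open>\<mu> (\<mu> a b) (\<alpha> c)\<close>; each of the six arrangements of the three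
    elements then occurs twice, with opposite signs.\<close>
  show "\<mu> (\<mu> x y - \<mu> y x) (\<alpha> z) - \<mu> (\<alpha> z) (\<mu> x y - \<mu> y x) +
      (\<mu> (\<mu> z x - \<mu> x z) (\<alpha> y) - \<mu> (\<alpha> y) (\<mu> z x - \<mu> x z)) +
      (\<mu> (\<mu> y z - \<mu> z y) (\<alpha> x) - \<mu> (\<alpha> x) (\<mu> y z - \<mu> z y)) = 0" for x y z
    by (simp add: mult_linear hom_assoc)
qed

section \<open>The cocommutator\<close>

lemma linear_cocommutator: "linear_tensor2 (cocommutator \<Delta>)"
  unfolding linear_tensor2_def
proof (intro conjI allI)
  show "cocommutator \<Delta> x \<in> tensors2" for x
    by (simp add: cocommutator_def tensors2_closed)
  show "cocommutator \<Delta> (x + y) = cocommutator \<Delta> x \<oplus>\<^sub>2 cocommutator \<Delta> y" for x y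
  proof (rule eval2_eqI)
    fix \<psi> assume \<psi>: "bilinear_form \<psi>"
    \<comment> \<open>The value of \<tau> (\<Delta> x) at \<psi> is that of \<Delta> x at the
      swapped form, so linearity of \<Delta> is used at both forms.\<close>
    note swap = bilinear_form_swap[OF \<psi>]
    show "eval2 \<psi> (cocommutator \<Delta> (x + y)) =
        eval2 \<psi> (cocommutator \<Delta> x \<oplus>\<^sub>2 cocommutator \<Delta> y)"
      by (simp add: eval2_cocommutator eval2_qadd \<psi> eval2_linear_tensor2[OF linear_comult \<psi>]
          eval2_linear_tensor2[OF linear_comult swap])
  qed (simp_all add: cocommutator_def tensors2_closed)
  show "cocommutator \<Delta> (scale c x) = qscale N2 c (cocommutator \<Delta> x)" for c x
  proof (rule eval2_eqI)
    fix \<psi> assume \<psi>: "bilinear_form \<psi>"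
    note swap = bilinear_form_swap[OF \<psi>]
    show "eval2 \<psi> (cocommutator \<Delta> (scale c x)) = eval2 \<psi> (qscale N2 c (cocommutator \<Delta> x))"
      by (simp add: eval2_cocommutator eval2_qscale \<psi> eval2_linear_tensor2[OF linear_comult \<psi>]
          eval2_linear_tensor2[OF linear_comult swap] right_diff_distrib)
  qed (simp_all add: cocommutator_def tensors2_closed)
qed

lemma bilinear_form_twist: "bilinear_form \<psi> \<Longrightarrow> bilinear_form (\<lambda>x y. \<psi> (\<alpha> x) (\<alpha> y))"
  by (simp add: bilinear_form_def twist_linear)

text \<open>Linearity in \<open>x\<close> comes from \<alpha>, linearity in \<open>y\<close> from
  \<Delta>. This contraction of \<phi> with \<alpha> \<otimes> \<Delta> has to be bilinear for the
  outer one of two nested cocommutators to be expanded.\<close>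

lemma bilinear_form_comult_right:
  assumes "trilinear_form \<phi>"
  shows "bilinear_form (\<lambda>x y. eval2 (\<lambda>u v. \<phi> (\<alpha> x) u v) (\<Delta> y))"
proof -
  have bil: "bilinear_form (\<phi> x)" for x
    using assms by (simp add: trilinear_form_def)
  \<comment> \<open>Stated for the forms as functions of \<open>u\<close> and \<open>v\<close>, so
    that they can be rewritten under \<open>eval2\<close>.\<close>
  have "(\<lambda>u v. \<phi> (\<alpha> (x + x')) u v) = (\<lambda>u v. \<phi> (\<alpha> x) u v + \<phi> (\<alpha> x') u v)"
    "(\<lambda>u v. \<phi> (\<alpha> (scale c x)) u v) = (\<lambda>u v. c * \<phi> (\<alpha> x) u v)" for x x' c
    by (simp_all only: twist_linear trilinear_formD[OF assms])
  then show ?thesis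
    unfolding bilinear_form_def[of "\<lambda>x y. eval2 (\<lambda>u v. \<phi> (\<alpha> x) u v) (\<Delta> y)"]
    by (simp only: eval2_linear eval2_linear_tensor2[OF linear_comult bil] simp_thms)
qed

text \<open>Evaluated on \<open>\<phi>\<close>, the iterated cocommutator is a signed sum of values of
  \<open>(\<alpha> \<otimes> \<Delta>) \<circ> \<Delta>\<close> on permutations of \<open>\<phi>\<close>; coassociativity puts the terms of the form
  \<open>\<Delta> \<otimes> \<alpha>\<close> into this shape.\<close>

lemma eval3_iterated_cocommutator:
  fixes a :: 'a
  assumes \<phi>: "trilinear_form \<phi>"
  defines "X \<equiv> \<lambda>\<phi>. eval3 \<phi> (map_left \<alpha> \<Delta> (\<Delta> a))"
  shows "eval3 \<phi> (map_left \<alpha> (cocommutator \<Delta>) (cocommutator \<Delta> a)) =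
    X \<phi> - X (\<lambda>x y z. \<phi> x z y) - X (\<lambda>x y z. \<phi> z x y) + X (\<lambda>x y z. \<phi> z y x)"
proof -
  have bil: "bilinear_form (\<phi> x)" for x
    using \<phi> by (simp add: trilinear_form_def)
  note perm = trilinear_form_perm[OF \<phi>]
  let ?c = "\<lambda>\<phi> x y. eval2 (\<lambda>u v. \<phi> (\<alpha> x) u v) (\<Delta> y)"
  have b1: "bilinear_form (?c \<phi>)"
    by (rule bilinear_form_comult_right[OF \<phi>])
  have b2: "bilinear_form (?c (\<lambda>x y z. \<phi> x z y))"
    by (rule bilinear_form_comult_right[OF perm(1)])
  have b: "bilinear_form (\<lambda>x y. ?c \<phi> x y - ?c (\<lambda>x y z. \<phi> x z y) x y)"
    by (rule bilinear_form_diff[OF b1 b2])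
  have "eval3 \<phi> (map_left \<alpha> (cocommutator \<Delta>) (cocommutator \<Delta> a)) =
    eval2 (\<lambda>x y. ?c \<phi> x y - ?c (\<lambda>x y z. \<phi> x z y) x y) (cocommutator \<Delta> a)"
    by (simp add: eval3_map_left[OF \<phi>] eval2_cocommutator bil)
  also have "\<dots> = eval2 (?c \<phi>) (\<Delta> a) - eval2 (?c (\<lambda>x y z. \<phi> x z y)) (\<Delta> a)
     - (eval2 (\<lambda>x y. ?c \<phi> y x) (\<Delta> a) - eval2 (\<lambda>x y. ?c (\<lambda>x y z. \<phi> x z y) y x) (\<Delta> a))"
    by (subst eval2_cocommutator[OF b]) (simp only: eval2_linear)
  \<comment> \<open>With the outer legs exchanged, \<Delta> acts on the first leg, so the value
    belongs to \<open>map_right\<close>; reading the arguments in that order gives the cyclic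
    rearrangement of \<phi>.\<close>
  also have "eval2 (\<lambda>x y. ?c \<phi> y x) (\<Delta> a) = X (\<lambda>x y z. \<phi> z x y)"
    by (simp add: X_def hom_coassoc eval3_map_right perm)
  also have "eval2 (\<lambda>x y. ?c (\<lambda>x y z. \<phi> x z y) y x) (\<Delta> a) = X (\<lambda>x y z. \<phi> z y x)"
    by (simp add: X_def hom_coassoc eval3_map_right perm)
  finally show ?thesis
    by (simp add: X_def eval3_map_left \<phi> perm)
qed

lemma hom_lie_coalgebra_cocommutator: "hom_lie_coalgebra scale (cocommutator \<Delta>) \<alpha>"
proof (intro hom_lie_coalgebra.intro hom_lie_coalgebra_axioms.intro tensor_powers_axioms)
  show "linear_tensor2 (cocommutator \<Delta>)"
    by (rule linear_cocommutator)
  show "Vector_Spaces.linear scale scale \<alpha>"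
    by (rule linear_twist)
  show "cocommutator \<Delta> (\<alpha> x) = map_tensor2 \<alpha> (cocommutator \<Delta> x)" for x
  proof (rule eval2_eqI)
    fix \<psi> assume \<psi>: "bilinear_form \<psi>"
    show "eval2 \<psi> (cocommutator \<Delta> (\<alpha> x)) = eval2 \<psi> (map_tensor2 \<alpha> (cocommutator \<Delta> x))"
      by (simp add: eval2_cocommutator[OF \<psi>] eval2_cocommutator[OF bilinear_form_twist[OF \<psi>]]
          eval2_map_tensor2 \<psi> bilinear_form_swap[OF \<psi>] flip: comult_twist)
  qed (simp_all add: cocommutator_def map_tensor2_def tensors2_closed)
  show "anti_symmetric (cocommutator \<Delta> x)" for x
    unfolding anti_symmetric_def
  proof (rule eval2_eqI)
    fix \<psi> assume \<psi>: "bilinear_form \<psi>"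
    show "eval2 \<psi> (twist (cocommutator \<Delta> x)) = eval2 \<psi> (quminus N2 (cocommutator \<Delta> x))"
      by (simp add: eval2_twist eval2_quminus eval2_cocommutator \<psi> bilinear_form_swap[OF \<psi>])
  qed (simp_all add: twist_def tensors2_closed)
  show "map_left \<alpha> (cocommutator \<Delta>) (cocommutator \<Delta> x)
      \<oplus>\<^sub>3 cyc (map_left \<alpha> (cocommutator \<Delta>) (cocommutator \<Delta> x))
      \<oplus>\<^sub>3 cyc (cyc (map_left \<alpha> (cocommutator \<Delta>) (cocommutator \<Delta> x))) = qzero N3" for x
  proof (rule eval3_eqI)
    fix \<phi> assume \<phi>: "trilinear_form \<phi>"
    note perm = trilinear_form_perm[OF \<phi>]
    \<comment> \<open>Of the four rearrangements in the iterated cocommutator, the two even ones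
      carry opposite signs, and so do the two odd ones. Summed over the cyclic shifts, both classes
      cancel.\<close>
    show "eval3 \<phi> (map_left \<alpha> (cocommutator \<Delta>) (cocommutator \<Delta> x)
      \<oplus>\<^sub>3 cyc (map_left \<alpha> (cocommutator \<Delta>) (cocommutator \<Delta> x))
      \<oplus>\<^sub>3 cyc (cyc (map_left \<alpha> (cocommutator \<Delta>) (cocommutator \<Delta> x)))) = eval3 \<phi> (qzero N3)"
      by (simp add: eval3_qadd eval3_qzero eval3_cyc eval3_iterated_cocommutator \<phi> perm)
  qed (simp_all add: tensors3_closed)
qed

end

section \<open>The coboundary structure and the compatibility of bracket and cobracket\<close>

context coboundary_eps_hom_bialgebra
begin

lemma eval2_comult:
  "bilinear_form \<psi> \<Longrightarrow> eval2 \<psi> (\<Delta> a) =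
    eval2 (\<lambda>u v. \<psi> (\<mu> a u) (\<alpha> v)) r - eval2 (\<lambda>u v. \<psi> (\<alpha> u) (\<mu> v a)) r"
  by (simp add: coboundary eval2_star_bracket)

text \<open>The terms of \<Delta> a are \<open>\<mu> a u \<otimes> \<alpha> v\<close> and
  \<open>- \<alpha> u \<otimes> \<mu> v a\<close>. Those of - \<tau> (\<Delta> a) become, once the
  legs of \<open>r\<close> are exchanged, \<open>\<alpha> u \<otimes> \<mu> a v\<close> and
  \<open>- \<mu> u a \<otimes> \<alpha> v\<close>, which completes the commutators.\<close>

lemma cocommutator_eq_ad:
  assumes r: "anti_symmetric r"
  shows "cocommutator \<Delta> a = ad (\<lambda>x y. \<mu> x y - \<mu> y x) \<alpha> a r"
proof (rule eval2_eqI)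
  fix \<psi> assume \<psi>: "bilinear_form \<psi>"
  have b1: "bilinear_form (\<lambda>u v. \<psi> (\<alpha> u) (\<mu> a v))"
    and b2: "bilinear_form (\<lambda>u v. \<psi> (\<mu> u a) (\<alpha> v))"
    by (simp_all add: bilinear_form_def bilinear_formD[OF \<psi>] mult_linear twist_linear)
  show "eval2 \<psi> (cocommutator \<Delta> a) = eval2 \<psi> (ad (\<lambda>x y. \<mu> x y - \<mu> y x) \<alpha> a r)"
    using eval2_anti_symmetric[OF r b1] eval2_anti_symmetric[OF r b2]
    by (simp add: eval2_cocommutator eval2_comult eval2_ad \<psi> bilinear_form_swap[OF \<psi>]
        bilinear_formD[OF \<psi>] eval2_linear)
qed (simp_all add: cocommutator_def ad_def tensors2_closed)

text \<open>The form obtained from Aguiar's balanceator of \<open>x\<close> and \<open>y\<close>. It is the obstruction to the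
  compatibility of the commutator with the cocommutator.\<close>

definition balanceator_form :: "('a \<Rightarrow> 'a \<Rightarrow> 'k) \<Rightarrow> 'a \<Rightarrow> 'a \<Rightarrow> 'k" where
  "balanceator_form \<psi> x y =
    eval2 (\<lambda>u v. \<psi> (\<mu> u (\<alpha> x)) (\<alpha> v)) (\<Delta> y) - eval2 (\<lambda>u v. \<psi> (\<alpha> u) (\<mu> (\<alpha> x) v)) (\<Delta> y)"

text \<open>With \<Delta> written in terms of \<open>r\<close>, exchanging legs and
  hom-associativity show that the swapped form at \<open>x\<close>, \<open>y\<close> is minus the
  plain form at \<open>y\<close>, \<open>x\<close>. Hence both sides equal
  \<open>balanceator_form \<psi> x y + balanceator_form \<psi> y x\<close>.\<close>

lemma balanceator_form_sym:
  assumes r: "anti_symmetric r" and \<psi>: "bilinear_form \<psi>"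
  shows "balanceator_form \<psi> x y - balanceator_form (\<lambda>u v. \<psi> v u) x y =
    balanceator_form \<psi> y x - balanceator_form (\<lambda>u v. \<psi> v u) y x"
proof -
  note lin = bilinear_form_def bilinear_formD[OF \<psi>] mult_linear twist_linear
  \<comment> \<open>The four shapes of terms that appear once \<Delta> is written in terms of
    \<open>r\<close>, for both orders of \<open>x\<close> and \<open>y\<close>.\<close>
  have b: "bilinear_form (\<lambda>u v. \<psi> (\<mu> (\<mu> x u) (\<alpha> y)) (\<alpha> (\<alpha> v)))"
    "bilinear_form (\<lambda>u v. \<psi> (\<alpha> (\<alpha> u)) (\<mu> (\<mu> x v) (\<alpha> y)))"
    "bilinear_form (\<lambda>u v. \<psi> (\<mu> (\<alpha> x) (\<alpha> u)) (\<mu> (\<alpha> y) (\<alpha> v)))"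
    "bilinear_form (\<lambda>u v. \<psi> (\<mu> (\<alpha> u) (\<alpha> x)) (\<mu> (\<alpha> v) (\<alpha> y)))" for x y
    by (simp_all add: lin)
  have c: "bilinear_form (\<lambda>u v. \<psi> (\<mu> u (\<alpha> x)) (\<alpha> v))"
    "bilinear_form (\<lambda>u v. \<psi> (\<alpha> u) (\<mu> (\<alpha> x) v))"
    "bilinear_form (\<lambda>u v. \<psi> (\<alpha> v) (\<mu> u (\<alpha> x)))"
    "bilinear_form (\<lambda>u v. \<psi> (\<mu> (\<alpha> x) v) (\<alpha> u))" for x
    by (simp_all add: lin)
  note anti = b[THEN eval2_anti_symmetric[OF r]]
  show ?thesis
    using anti[of x y] anti[of y x]
    by (simp add: balanceator_form_def eval2_comult c mult_twist hom_assoc)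
qed

text \<open>By \<open>compatibility\<close>, the left side minus the right side is Id - \<tau>
  applied to the balanceator of \<open>x\<close>, \<open>y\<close> minus that of \<open>y\<close>,
  \<open>x\<close>; this vanishes by \<open>balanceator_form_sym\<close>.\<close>

lemma cocommutator_commutator:
  assumes r: "anti_symmetric r"
  shows "cocommutator \<Delta> (\<mu> x y - \<mu> y x) =
    ad (\<lambda>x y. \<mu> x y - \<mu> y x) \<alpha> (\<alpha> x) (cocommutator \<Delta> y)
    \<ominus>\<^sub>2 ad (\<lambda>x y. \<mu> x y - \<mu> y x) \<alpha> (\<alpha> y) (cocommutator \<Delta> x)"
proof (rule eval2_eqI)
  fix \<psi> assume \<psi>: "bilinear_form \<psi>"
  note lin = bilinear_form_def bilinear_formD[OF \<psi>] mult_linear twist_linear algebra_simps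
  have \<psi>': "bilinear_form (\<lambda>u v. \<psi> v u)"
    using \<psi> by (rule bilinear_form_swap)
  have b: "bilinear_form (\<lambda>u v. \<psi> (\<mu> x u) (\<alpha> v))" "bilinear_form (\<lambda>u v. \<psi> (\<mu> u x) (\<alpha> v))"
    "bilinear_form (\<lambda>u v. \<psi> (\<alpha> u) (\<mu> x v))" "bilinear_form (\<lambda>u v. \<psi> (\<alpha> u) (\<mu> v x))" for x
    by (simp_all add: lin)
  \<comment> \<open>Stated for every form, as it is used at \<psi> and, because of \<tau>, at the
    swapped form.\<close>
  have mult: "eval2 \<psi> (\<Delta> (\<mu> x y)) =
    eval2 (\<lambda>u v. \<psi> (\<mu> (\<alpha> x) u) (\<alpha> v)) (\<Delta> y) + eval2 (\<lambda>u v. \<psi> (\<alpha> u) (\<mu> v (\<alpha> y))) (\<Delta> x)"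
    if "bilinear_form \<psi>" for \<psi> x y
    by (simp add: compatibility eval2_qadd eval2_lift eval2_pure2 that)
  show "eval2 \<psi> (cocommutator \<Delta> (\<mu> x y - \<mu> y x)) =
    eval2 \<psi> (ad (\<lambda>x y. \<mu> x y - \<mu> y x) \<alpha> (\<alpha> x) (cocommutator \<Delta> y)
    \<ominus>\<^sub>2 ad (\<lambda>x y. \<mu> x y - \<mu> y x) \<alpha> (\<alpha> y) (cocommutator \<Delta> x))"
    using balanceator_form_sym[OF r \<psi>, of x y]
    by (simp add: eval2_cocommutator eval2_qminus eval2_ad \<psi> \<psi>' b bilinear_formD[OF \<psi>]
        eval2_linear_tensor2[OF linear_comult] mult balanceator_form_def eval2_linear) algebra
qed (simp_all add: cocommutator_def tensors2_closed)

end

section \<open>The classical Hom-Yang-Baxter equation\<close>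

context quasi_triangular_eps_hom_bialgebra
begin

text \<open>The three commutators give six products. Up to renaming of indices, three of them are
  the terms of \<open>A(r)\<close> with opposite signs; the other three are, after exchanging legs,
  the terms of its reversal.\<close>

lemma CYB_commutator_zero:
  assumes r: "anti_symmetric r"
  shows "CYB (\<lambda>x y. \<mu> x y - \<mu> y x) \<alpha> r = qzero N3"
proof (rule eval3_eqI)
  fix \<phi> assume \<phi>: "trilinear_form \<phi>"
  note perm = trilinear_form_perm[OF \<phi>]
  let ?S = "\<lambda>f. eval2 (\<lambda>u v. eval2 (\<lambda>u' v'. f u v u' v') r) r"
  have AYB: "?S (\<lambda>u v u' v'. \<phi> (\<mu> u u') (\<alpha> v') (\<alpha> v))
      - ?S (\<lambda>u v u' v'. \<phi> (\<alpha> u) (\<mu> v u') (\<alpha> v'))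
      + ?S (\<lambda>u v u' v'. \<phi> (\<alpha> u') (\<alpha> u) (\<mu> v v')) = 0" if \<phi>: "trilinear_form \<phi>" for \<phi>
    using arg_cong[OF AYB_zero, of "eval3 \<phi>"]
    by (simp add: AYB_def eval3_qadd eval3_qminus eval3_qzero eval3_double_sum eval3_pure3 \<phi>)
  note lin = bilinear_form_def trilinear_formD[OF \<phi>] mult_linear twist_linear
  \<comment> \<open>On the left are, up to sign, the terms of \<open>A(r)\<close> at the reversed
    form. Exchanging the legs of both copies of \<open>r\<close> turns them into terms of
    \<open>C(r)\<close>, the second one up to sign and renaming of indices.\<close>
  have flip1: "?S (\<lambda>u v u' v'. \<phi> (\<alpha> v) (\<alpha> v') (\<mu> u u')) = ?S (\<lambda>u v u' v'. \<phi> (\<alpha> u) (\<alpha> u') (\<mu> v v'))"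
    and flip2: "?S (\<lambda>u v u' v'. \<phi> (\<alpha> v') (\<mu> v u') (\<alpha> u)) = ?S (\<lambda>u v u' v'. \<phi> (\<alpha> u') (\<mu> u v') (\<alpha> v))"
    and flip3: "?S (\<lambda>u v u' v'. \<phi> (\<mu> v v') (\<alpha> u) (\<alpha> u')) = ?S (\<lambda>u v u' v'. \<phi> (\<mu> u u') (\<alpha> v) (\<alpha> v'))"
    using eval2_eval2_anti_symmetric[OF r, of "\<lambda>u v u' v'. \<phi> (\<alpha> u) (\<alpha> u') (\<mu> v v')"]
      eval2_eval2_anti_symmetric[OF r, of "\<lambda>u v u' v'. \<phi> (\<alpha> u') (\<mu> u v') (\<alpha> v)"]
      eval2_eval2_anti_symmetric[OF r, of "\<lambda>u v u' v'. \<phi> (\<mu> u u') (\<alpha> v) (\<alpha> v')"]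
    by (simp_all add: lin)
  \<comment> \<open>These only interchange the two copies of \<open>r\<close>, that is, the indices
    \<open>i\<close> and \<open>j\<close>.\<close>
  have swap1: "?S (\<lambda>u v u' v'. \<phi> (\<mu> u' u) (\<alpha> v) (\<alpha> v')) = ?S (\<lambda>u v u' v'. \<phi> (\<mu> u u') (\<alpha> v') (\<alpha> v))"
    and swap2: "?S (\<lambda>u v u' v'. \<phi> (\<alpha> u) (\<mu> u' v) (\<alpha> v')) = ?S (\<lambda>u v u' v'. \<phi> (\<alpha> u') (\<mu> u v') (\<alpha> v))"
    and swap3: "?S (\<lambda>u v u' v'. \<phi> (\<alpha> u) (\<alpha> u') (\<mu> v' v)) = ?S (\<lambda>u v u' v'. \<phi> (\<alpha> u') (\<alpha> u) (\<mu> v v'))"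
    by (rule eval2_commute)+
  show "eval3 \<phi> (CYB (\<lambda>x y. \<mu> x y - \<mu> y x) \<alpha> r) = eval3 \<phi> (qzero N3)"
    \<comment> \<open>The second instance is at \<phi> with its three arguments reversed.\<close>
    using AYB[OF \<phi>] AYB[OF perm(5)]
    by (simp add: CYB_def eval3_qadd eval3_qzero eval3_double_sum eval3_pure3 \<phi>
        trilinear_formD[OF \<phi>] eval2_linear flip1 flip2 flip3 swap1 swap2 swap3) algebra
qed (simp_all add: CYB_def tensors3_closed)

lemma quasi_triangular_hom_lie_bialgebra_commutator:
  assumes r: "anti_symmetric r"
  shows "quasi_triangular_hom_lie_bialgebra scale (\<lambda>x y. \<mu> x y - \<mu> y x) (cocommutator \<Delta>) \<alpha> r"
proof -
  \<comment> \<open>With both structures interpreted, what remains is the compatibility, \<delta> =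
    ad(r), the conditions on \<open>r\<close> and the Yang-Baxter equation.\<close>
  interpret L: hom_lie_algebra scale "\<lambda>x y. \<mu> x y - \<mu> y x" \<alpha>
    by (rule hom_lie_algebra_commutator)
  interpret C: hom_lie_coalgebra scale "cocommutator \<Delta>" \<alpha>
    by (rule hom_lie_coalgebra_cocommutator)
  show ?thesis
    by unfold_locales
      (rule cocommutator_commutator[OF r] r_tensor r_invariant cocommutator_eq_ad[OF r]
        CYB_commutator_zero[OF r])+
qed

end

theorem corollary7p9:
  fixes scale :: "'k::field_char_0 \<Rightarrow> 'a::ab_group_add \<Rightarrow> 'a"
    and \<mu> :: "'a \<Rightarrow> 'a \<Rightarrow> 'a"
    and \<Delta> :: "'a \<Rightarrow> ('a \<times> 'a \<Rightarrow>\<^sub>0 'k) set"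
    and \<alpha> :: "'a \<Rightarrow> 'a"
    and r :: "('a \<times> 'a \<Rightarrow>\<^sub>0 'k) set"
  assumes "quasi_triangular_eps_hom_bialgebra scale \<mu> \<Delta> \<alpha> r"
    and "tensor_powers.anti_symmetric scale r"
  shows "quasi_triangular_hom_lie_bialgebra scale
    (\<lambda>x y. \<mu> x y - \<mu> y x)
    (tensor_powers.cocommutator scale \<Delta>)
    \<alpha> r"
proof -
  interpret quasi_triangular_eps_hom_bialgebra scale \<mu> \<Delta> \<alpha> r
    by (rule assms(1))
  show ?thesis
    using assms(2) by (rule quasi_triangular_hom_lie_bialgebra_commutator)
qed

end
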